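(* Consider $N\ge2$ agents $x_i(k+1)=Ax_i(k)+Bu_i(k)$, $y_i(k)=Cx_i(k)$, $i=1,\dots,N$, where all eigenvalues of $A$ lie in the closed unit disc, $(A,B)$ is stabilizable and $(C,A)$ is detectable. Let $K$ be such that $A-BK$ is Schur stable and $H$ be such that $A-HC$ is Schur stable. Each agent $i$ uses the protocol $$\begin{aligned}\eta_i(k+1)&=A\eta_i(k)+Bu_i(k)+A\hat x_i(k)-A\hat\zeta_i(k),\\ \hat x_i(k+1)&=A\hat x_i(k)-BK\hat\zeta_i(k)+H(\zeta_i(k)-C\hat x_i(k)),\\ u_i(k)&=-K\eta_i(k),\end{aligned}$$ with $\zeta_i(k)=\sum_{j=1}^N d_{ij}(y_i(k)-y_j(k))$ and $\hat\zeta_i(k)=\sum_{j=1}^N d_{ij}(\eta_i(k)-\eta_j(k))$. Then for every $N$, every weighted directed graph on $N$ nodes containing a directed spanning tree, and all initial conditions, $\lim_{k\to\infty}(x_i(k)-x_j(k))=0$ for all $i,j$. In particular, the scalable state synchronization problem with localized information exchange (partial-state coupling) is solvable by a protocol designed using only $(C,A,B)$.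
   Context: The network is a weighted directed graph with adjacency matrix $[a_{ij}]$, $a_{ij}\ge0$, $a_{ii}=0$ ($a_{ij}>0$ means an edge from $j$ to $i$); weighted in-degree $d_{in}(i)=\sum_j a_{ij}$. The row stochastic matrix $D=[d_{ij}]$ is given by $d_{ij}=a_{ij}/(1+d_{in}(i))$ for $j\ne i$ and $d_{ii}=1/(1+d_{in}(i))$, so $\zeta_i=\frac{1}{1+d_{in}(i)}\sum_j a_{ij}(y_i-y_j)$. Schur stable means all eigenvalues in the open unit disc. A directed spanning tree is a subgraph containing all nodes in which every node except one root has exactly one parent. *)

theory Defs
  imports "HOL-Analysis.Analysis"
begin

text \<open>Complexification of a real matrix.\<close>
definition cmat :: "real^'c^'r \<Rightarrow> complex^'c^'r" where
  "cmat M = (\<chi> i j. complex_of_real (M $ i $ j))"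

text \<open>Complex eigenvalue of a real square matrix.\<close>
definition is_eigenvalue :: "real^'n^'n \<Rightarrow> complex \<Rightarrow> bool" where
  "is_eigenvalue M lam \<longleftrightarrow> (\<exists>v::complex^'n. v \<noteq> 0 \<and> cmat M *v v = lam *s v)"

definition schur_stable :: "real^'n^'n \<Rightarrow> bool" where
  "schur_stable M \<longleftrightarrow> (\<forall>lam. is_eigenvalue M lam \<longrightarrow> cmod lam < 1)"

text \<open>PBH tests: (A,B) stabilizable iff no left eigenvector w of A with eigenvalue
  |lam| >= 1 satisfies w^* B = 0;  (C,A) detectable iff no right eigenvector v of A with
  |lam| >= 1 satisfies C v = 0.\<close>
definition stabilizable :: "real^'n^'n \<Rightarrow> real^'m^'n \<Rightarrow> bool" where
  "stabilizable A B \<longleftrightarrow>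
     (\<forall>lam (w::complex^'n). w \<noteq> 0 \<and> w v* cmat A = lam *s w \<and> cmod lam \<ge> 1
        \<longrightarrow> w v* cmat B \<noteq> 0)"

definition detectable :: "real^'n^'p \<Rightarrow> real^'n^'n \<Rightarrow> bool" where
  "detectable C A \<longleftrightarrow>
     (\<forall>lam (v::complex^'n). v \<noteq> 0 \<and> cmat A *v v = lam *s v \<and> cmod lam \<ge> 1
        \<longrightarrow> cmat C *v v \<noteq> 0)"

text \<open>Weighted digraph on nodes {0..<N}: a i j > 0 is an edge from j to i.\<close>
definition weighted_digraph :: "nat \<Rightarrow> (nat \<Rightarrow> nat \<Rightarrow> real) \<Rightarrow> bool" where
  "weighted_digraph N a \<longleftrightarrow> (\<forall>i<N. a i i = 0 \<and> (\<forall>j<N. a i j \<ge> 0))"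

definition din :: "nat \<Rightarrow> (nat \<Rightarrow> nat \<Rightarrow> real) \<Rightarrow> nat \<Rightarrow> real" where
  "din N a i = (\<Sum>j<N. a i j)"

definition dmat :: "nat \<Rightarrow> (nat \<Rightarrow> nat \<Rightarrow> real) \<Rightarrow> nat \<Rightarrow> nat \<Rightarrow> real" where
  "dmat N a i j = (if j = i then 1 / (1 + din N a i) else a i j / (1 + din N a i))"

text \<open>Directed spanning tree: a root r and a parent map with an edge par i \<rightarrow> i for each
  non-root node, such that following parents from any node reaches the root.\<close>
definition has_spanning_tree :: "nat \<Rightarrow> (nat \<Rightarrow> nat \<Rightarrow> real) \<Rightarrow> bool" where
  "has_spanning_tree N a \<longleftrightarrow>
     (\<exists>r<N. \<exists>par. (\<forall>i<N. i \<noteq> r \<longrightarrow> par i < N \<and> a i (par i) > 0) \<and>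
                  (\<forall>i<N. \<exists>k. (par ^^ k) i = r))"

end

theory Submission
  imports Defs "Jordan_Normal_Form.Spectral_Radius"
begin

(* Write w_i = x_i - eta_i and let e_i = (\<Sum>j. d_ij (x_i - x_j)) - xh_i be the error of the observer xh_i.
   The closed loop decouples into
     e_i(k+1) = (A - HC) e_i(k),
     w_i(k+1) = A (\<Sum>j. d_ij w_j(k) + e_i(k)),
     x_i(k+1) = (A - BK) x_i(k) + BK w_i(k).
   So e decays geometrically. Unrolling the recurrence for w expresses w_i - w_j through differences of
   rows of D^s, which decay geometrically because D is row stochastic and the root of the spanning tree
   receives weight from every node within a bounded number of steps, multiplied by powers of A, which
   grow at most polynomially because the eigenvalues of A lie in the closed unit disc. Hence w_i - w_j
   decays like a polynomial times a geometric sequence, and then so does x_i - x_j, the state of the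
   Schur stable system A - BK driven by BK (w_i - w_j). *)

section \<open>Sequences decaying like a polynomial times a geometric sequence\<close>

definition poly_exp_decay :: "(nat \<Rightarrow> 'a::real_normed_vector) \<Rightarrow> bool" where
  "poly_exp_decay f \<longleftrightarrow>
     (\<exists>c D \<tau>. 0 < \<tau> \<and> \<tau> < 1 \<and> (\<forall>k. norm (f k) \<le> c * (real k + 1) ^ D * \<tau> ^ k))"

definition poly_exp_decay_op :: "(nat \<Rightarrow> 'a::real_normed_vector \<Rightarrow> 'b::real_normed_vector) \<Rightarrow> bool" where
  "poly_exp_decay_op F \<longleftrightarrow>
     (\<exists>c D \<tau>. 0 < \<tau> \<and> \<tau> < 1 \<and> (\<forall>k v. norm (F k v) \<le> c * (real k + 1) ^ D * \<tau> ^ k * norm v))"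

lemma poly_exp_decayE:
  assumes "poly_exp_decay f"
  obtains c \<tau> D where "0 \<le> c" "0 < \<tau>" "\<tau> < 1" "\<And>k. norm (f k) \<le> c * (real k + 1) ^ D * \<tau> ^ k"
proof -
  obtain c D \<tau> where \<tau>: "0 < \<tau>" "\<tau> < 1" and f: "\<And>k. norm (f k) \<le> c * (real k + 1) ^ D * \<tau> ^ k"
    using assms by (auto simp: poly_exp_decay_def)
  have "0 \<le> c" using order_trans[OF norm_ge_zero f[of 0]] by simp
  show thesis using \<open>0 \<le> c\<close> \<tau> f by (rule that)
qed

lemma poly_exp_decay_opE:
  assumes "poly_exp_decay_op F"
  obtains c \<tau> D where "0 \<le> c" "0 < \<tau>" "\<tau> < 1"
    "\<And>k v. norm (F k v) \<le> c * (real k + 1) ^ D * \<tau> ^ k * norm v"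
proof -
  obtain c D \<tau> where \<tau>: "0 < \<tau>" "\<tau> < 1"
    and F: "\<And>k v. norm (F k v) \<le> c * (real k + 1) ^ D * \<tau> ^ k * norm v"
    using assms by (auto simp: poly_exp_decay_op_def)
  have "norm (F k v) \<le> \<bar>c\<bar> * (real k + 1) ^ D * \<tau> ^ k * norm v" for k v
    using F[of k v] mult_right_mono[OF abs_ge_self[of c], of "(real k + 1) ^ D * \<tau> ^ k * norm v"] \<tau>
    by (simp add: ac_simps)
  with \<tau> show thesis by (intro that[of "\<bar>c\<bar>"]) auto
qed

lemma poly_times_geometric_tendsto_zero:
  assumes "0 < \<tau>" "\<tau> < 1"
  shows "(\<lambda>k. (real k + 1) ^ D * \<tau> ^ k) \<longlonglongrightarrow> 0"
proof (cases "D = 0")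
  case True
  then show ?thesis using assms by (simp add: LIMSEQ_realpow_zero)
next
  case False
  define \<rho> where "\<rho> = root D \<tau>"
  have \<rho>: "0 < \<rho>" "\<rho> < 1" "\<rho> ^ D = \<tau>"
    using assms False by (auto simp: \<rho>_def real_root_pow_pos2)
  have "(\<lambda>k. real k * \<rho> ^ k + \<rho> ^ k) \<longlonglongrightarrow> 0 + 0"
    using \<rho> by (intro tendsto_add powser_times_n_limit_0 LIMSEQ_realpow_zero) auto
  then have "(\<lambda>k. ((real k + 1) * \<rho> ^ k) ^ D) \<longlonglongrightarrow> 0 ^ D"
    by (intro tendsto_power) (simp add: distrib_right)
  moreover have "((real k + 1) * \<rho> ^ k) ^ D = (real k + 1) ^ D * \<tau> ^ k" for k
    by (simp add: power_mult_distrib flip: \<rho>(3) power_mult) (simp add: mult.commute)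
  ultimately show ?thesis using False by (simp add: power_0_left)
qed

lemma poly_exp_decay_tendsto_zero:
  assumes "poly_exp_decay f"
  shows "f \<longlonglongrightarrow> 0"
proof -
  obtain c \<tau> D where "0 \<le> c" "0 < \<tau>" "\<tau> < 1"
    and f: "\<And>k. norm (f k) \<le> c * (real k + 1) ^ D * \<tau> ^ k"
    using assms by (rule poly_exp_decayE) blast
  then have lim: "(\<lambda>k. c * ((real k + 1) ^ D * \<tau> ^ k)) \<longlonglongrightarrow> 0"
    by (intro tendsto_mult_right_zero poly_times_geometric_tendsto_zero)
  have "\<forall>k. norm (f k) \<le> c * ((real k + 1) ^ D * \<tau> ^ k)"
    using f by (simp add: mult.assoc)
  then show ?thesis
    using Lim_null_comparison[OF always_eventually lim] by blast
qed

lemma poly_exp_decay_add: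
  assumes "poly_exp_decay f" "poly_exp_decay g"
  shows "poly_exp_decay (\<lambda>k. f k + g k)"
proof -
  obtain c1 \<tau>1 D1 where c1: "0 \<le> c1" "0 < \<tau>1" "\<tau>1 < 1"
    and f: "\<And>k. norm (f k) \<le> c1 * (real k + 1) ^ D1 * \<tau>1 ^ k"
    using assms(1) by (rule poly_exp_decayE) blast
  obtain c2 \<tau>2 D2 where c2: "0 \<le> c2" "0 < \<tau>2" "\<tau>2 < 1"
    and g: "\<And>k. norm (g k) \<le> c2 * (real k + 1) ^ D2 * \<tau>2 ^ k"
    using assms(2) by (rule poly_exp_decayE) blast
  define D where "D = max D1 D2"
  define \<tau> where "\<tau> = max \<tau>1 \<tau>2"
  have le: "c * (real k + 1) ^ D' * \<tau>' ^ k \<le> c * (real k + 1) ^ D * \<tau> ^ k"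
    if "0 \<le> c" "D' \<le> D" "0 < \<tau>'" "\<tau>' \<le> \<tau>" for c D' \<tau>' k
    using that by (intro mult_mono mult_left_mono power_increasing power_mono) auto
  have "norm (f k + g k) \<le> (c1 + c2) * (real k + 1) ^ D * \<tau> ^ k" for k
  proof -
    have "norm (f k + g k) \<le> c1 * (real k + 1) ^ D1 * \<tau>1 ^ k + c2 * (real k + 1) ^ D2 * \<tau>2 ^ k"
      by (rule norm_triangle_le[OF add_mono[OF f g]])
    also have "\<dots> \<le> c1 * (real k + 1) ^ D * \<tau> ^ k + c2 * (real k + 1) ^ D * \<tau> ^ k"
      using c1 c2 by (intro add_mono le) (auto simp: D_def \<tau>_def)
    finally show ?thesis by (simp add: distrib_right)
  qed
  then show ?thesis
    unfolding poly_exp_decay_def using c1 c2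
    by (intro exI[of _ "c1 + c2"] exI[of _ D] exI[of _ \<tau>]) (auto simp: \<tau>_def)
qed

lemma poly_exp_decay_sum:
  assumes "finite S" "\<And>j. j \<in> S \<Longrightarrow> poly_exp_decay (f j)"
  shows "poly_exp_decay (\<lambda>k. \<Sum>j\<in>S. f j k)"
  using assms
proof (induction S rule: finite_induct)
  case empty
  show ?case unfolding poly_exp_decay_def by (intro exI[of _ 0] exI[of _ 0] exI[of _ "1/2"]) simp
next
  case (insert j S)
  then show ?case by (simp add: poly_exp_decay_add)
qed

lemma poly_exp_decay_bounded_linear:
  assumes "bounded_linear L" "poly_exp_decay f"
  shows "poly_exp_decay (\<lambda>k. L (f k))"
proof -
  obtain B where B: "0 < B" "\<And>v. norm (L v) \<le> norm v * B"
    using bounded_linear.pos_bounded[OF assms(1)] by blast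
  obtain c \<tau> D where "0 \<le> c" "0 < \<tau>" "\<tau> < 1" and f: "\<And>k. norm (f k) \<le> c * (real k + 1) ^ D * \<tau> ^ k"
    using assms(2) by (rule poly_exp_decayE) blast
  moreover have "norm (L (f k)) \<le> (B * c) * (real k + 1) ^ D * \<tau> ^ k" for k
  proof -
    have "norm (L (f k)) \<le> B * norm (f k)" using B(2) by (simp add: mult.commute)
    also have "\<dots> \<le> B * (c * (real k + 1) ^ D * \<tau> ^ k)" using B(1) f by (intro mult_left_mono) auto
    finally show ?thesis by (simp add: ac_simps)
  qed
  ultimately show ?thesis unfolding poly_exp_decay_def by blast
qed

lemma poly_exp_decay_op_apply:
  assumes "poly_exp_decay_op F"
  shows "poly_exp_decay (\<lambda>k. F k v)"
proof -
  obtain c \<tau> D where "0 \<le> c" "0 < \<tau>" "\<tau> < 1"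
    and F: "\<And>k v. norm (F k v) \<le> c * (real k + 1) ^ D * \<tau> ^ k * norm v"
    using assms by (rule poly_exp_decay_opE) blast
  moreover have "norm (F k v) \<le> (c * norm v) * (real k + 1) ^ D * \<tau> ^ k" for k
    using F[of k v] by (simp add: ac_simps)
  ultimately show ?thesis unfolding poly_exp_decay_def by blast
qed

lemma poly_exp_decay_op_scaleR:
  assumes a: "poly_exp_decay a" and G: "\<And>k v. norm (G k v) \<le> c * (real k + 1) ^ D * norm v"
  shows "poly_exp_decay_op (\<lambda>k v. a k *\<^sub>R G k v)"
proof -
  obtain ca \<tau> Da where "0 \<le> ca" "0 < \<tau>" "\<tau> < 1"
    and a: "\<And>k. norm (a k) \<le> ca * (real k + 1) ^ Da * \<tau> ^ k"
    using a by (rule poly_exp_decayE) blast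
  moreover have "norm (a k *\<^sub>R G k v) \<le> (ca * c) * (real k + 1) ^ (Da + D) * \<tau> ^ k * norm v" for k v
  proof -
    have "norm (a k *\<^sub>R G k v) \<le> (ca * (real k + 1) ^ Da * \<tau> ^ k) * (c * (real k + 1) ^ D * norm v)"
      using a[of k] G[of k v] by (auto intro: mult_mono order_trans[OF norm_ge_zero])
    then show ?thesis by (simp add: power_add ac_simps)
  qed
  ultimately show ?thesis unfolding poly_exp_decay_op_def by blast
qed

lemma poly_exp_decay_convolution:
  assumes "poly_exp_decay_op F" "poly_exp_decay g"
  shows "poly_exp_decay (\<lambda>k. \<Sum>t<k. F (k - 1 - t) (g t))"
proof -
  obtain c \<sigma> D where c: "0 \<le> c" "0 < \<sigma>" "\<sigma> < 1"
    and F: "\<And>k v. norm (F k v) \<le> c * (real k + 1) ^ D * \<sigma> ^ k * norm v"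
    using assms(1) by (rule poly_exp_decay_opE) blast
  obtain cg \<tau> Dg where cg: "0 \<le> cg" "0 < \<tau>" "\<tau> < 1"
    and g: "\<And>k. norm (g k) \<le> cg * (real k + 1) ^ Dg * \<tau> ^ k"
    using assms(2) by (rule poly_exp_decayE) blast
  define \<mu> where "\<mu> = max \<sigma> \<tau>"
  have \<mu>: "0 < \<mu>" "\<mu> < 1" "\<sigma> \<le> \<mu>" "\<tau> \<le> \<mu>" using c cg by (auto simp: \<mu>_def)
  define C where "C k = c * cg * (real k + 1) ^ (D + Dg)" for k
  have C: "0 \<le> C k" for k using c cg by (simp add: C_def)
  have summand: "norm (F (k - 1 - t) (g t)) \<le> C k * \<mu> ^ (k - 1)" if t: "t < k" for k t
  proof -
    have "norm (F (k - 1 - t) (g t))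
          \<le> (c * (real k + 1) ^ D * \<mu> ^ (k - 1 - t)) * (cg * (real k + 1) ^ Dg * \<mu> ^ t)"
    proof (rule order_trans[OF F mult_mono])
      show "c * (real (k - 1 - t) + 1) ^ D * \<sigma> ^ (k - 1 - t) \<le> c * (real k + 1) ^ D * \<mu> ^ (k - 1 - t)"
        using c \<mu> by (intro mult_mono power_mono mult_left_mono) auto
      have "cg * (real t + 1) ^ Dg * \<tau> ^ t \<le> cg * (real k + 1) ^ Dg * \<mu> ^ t"
        using cg \<mu> t by (intro mult_mono mult_left_mono power_mono) auto
      then show "norm (g t) \<le> cg * (real k + 1) ^ Dg * \<mu> ^ t"
        using g[of t] by linarith
    qed (use c \<mu> in auto)
    also have "\<dots> = C k * (\<mu> ^ (k - 1 - t) * \<mu> ^ t)"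
      by (simp add: C_def power_add ac_simps)
    also have "\<mu> ^ (k - 1 - t) * \<mu> ^ t = \<mu> ^ (k - 1)"
      using t by (simp flip: power_add)
    finally show ?thesis .
  qed
  have "norm (\<Sum>t<k. F (k - 1 - t) (g t)) \<le> (c * cg / \<mu>) * (real k + 1) ^ (D + Dg + 1) * \<mu> ^ k" for k
  proof (cases k)
    case (Suc k')
    have "norm (\<Sum>t<k. F (k - 1 - t) (g t)) \<le> (\<Sum>t<k. norm (F (k - 1 - t) (g t)))"
      by (rule norm_sum)
    also have "\<dots> \<le> (\<Sum>t<k. C k * \<mu> ^ (k - 1))"
      by (rule sum_mono) (rule summand, simp)
    also have "\<dots> = real k * (C k * \<mu> ^ k')"
      using Suc by simp
    also have "\<dots> \<le> (real k + 1) * (C k * \<mu> ^ k')"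
      using C \<mu> by (intro mult_right_mono) auto
    also have "\<dots> = (c * cg / \<mu>) * (real k + 1) ^ (D + Dg + 1) * \<mu> ^ k"
      using \<mu> Suc by (simp add: C_def field_simps)
    finally show ?thesis .
  qed (use c cg \<mu> in simp)
  then show ?thesis unfolding poly_exp_decay_def using \<mu> by blast
qed

section \<open>Powers of a matrix with bounded eigenvalues\<close>

(* The spectral bounds of Jordan_Normal_Form are transferred to vectors indexed by a finite type
   along a fixed enumeration of that type. *)

definition enum_pos :: "'n::finite \<Rightarrow> nat" where
  "enum_pos = (SOME f. bij_betw f UNIV {..<CARD('n)})"

definition enum_at :: "nat \<Rightarrow> 'n::finite" where
  "enum_at = inv_into UNIV enum_pos"

lemma bij_enum_pos: "bij_betw (enum_pos :: 'n::finite \<Rightarrow> nat) UNIV {..<CARD('n)}"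
proof -
  have "\<exists>f. bij_betw f (UNIV :: 'n set) {..<CARD('n)}"
    using ex_bij_betw_finite_nat[of "UNIV :: 'n set"] by (auto simp: atLeast0LessThan)
  then show ?thesis unfolding enum_pos_def by (rule someI_ex)
qed

lemma enum_pos_less [simp]: "enum_pos (p :: 'n::finite) < CARD('n)"
  using bij_enum_pos[where 'n='n] by (auto simp: bij_betw_def)

lemma enum_at_enum_pos [simp]: "enum_at (enum_pos (p :: 'n::finite)) = p"
  using bij_enum_pos[where 'n='n] by (simp add: enum_at_def bij_betw_def)

lemma enum_pos_enum_at [simp]: "i < CARD('n::finite) \<Longrightarrow> enum_pos (enum_at i :: 'n) = i"
  using bij_enum_pos[where 'n='n] by (simp add: enum_at_def bij_betw_def f_inv_into_f)

lemma sum_enum_at: "(\<Sum>i<CARD('n::finite). g (enum_at i :: 'n)) = (\<Sum>p\<in>UNIV. g p)"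
  by (rule sum.reindex_bij_betw) (simp add: enum_at_def bij_betw_inv_into[OF bij_enum_pos])

definition to_vec :: "'a^'n::finite \<Rightarrow> 'a Matrix.vec" where
  "to_vec v = Matrix.vec CARD('n) (\<lambda>i. v $ enum_at i)"

definition to_mat :: "'a^'n::finite^'n \<Rightarrow> 'a mat" where
  "to_mat M = Matrix.mat CARD('n) CARD('n) (\<lambda>(i, j). M $ enum_at i $ enum_at j)"

lemma to_vec_carrier [simp]: "to_vec (v :: 'a^'n::finite) \<in> carrier_vec CARD('n)"
  and dim_to_vec [simp]: "dim_vec (to_vec (v :: 'a^'n::finite)) = CARD('n)"
  and to_mat_carrier [simp]: "to_mat (M :: 'a^'n::finite^'n) \<in> carrier_mat CARD('n) CARD('n)"
  and dim_row_to_mat [simp]: "dim_row (to_mat (M :: 'a^'n::finite^'n)) = CARD('n)"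
  and dim_col_to_mat [simp]: "dim_col (to_mat (M :: 'a^'n::finite^'n)) = CARD('n)"
  by (simp_all add: to_vec_def to_mat_def)

lemma to_vec_enum_pos [simp]: "to_vec v $ enum_pos p = v $ p"
  by (simp add: to_vec_def)

lemma to_vec_inject: "to_vec v = to_vec w \<longleftrightarrow> v = w"
proof
  assume "to_vec v = to_vec w"
  then have "v $ p = w $ p" for p by (metis to_vec_enum_pos)
  then show "v = w" by (simp add: Finite_Cartesian_Product.vec_eq_iff)
qed simp

lemma to_vec_surj: "u \<in> carrier_vec CARD('n::finite) \<Longrightarrow> to_vec (\<chi> p::'n. u $ enum_pos p) = u"
  by (intro eq_vecI) (auto simp: to_vec_def)

lemma to_vec_zero: "to_vec (0 :: 'a::zero^'n::finite) = 0\<^sub>v CARD('n)"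
  and to_vec_smult: "to_vec (c *s v) = c \<cdot>\<^sub>v to_vec v"
  by (auto intro!: eq_vecI simp: to_vec_def)

lemma to_vec_mult: "to_vec (M *v v) = to_mat M *\<^sub>v to_vec (v :: 'a::semiring_1^'n::finite)"
proof (rule eq_vecI)
  fix i assume "i < dim_vec (to_mat M *\<^sub>v to_vec v)"
  then have i: "i < CARD('n)" by (simp add: to_mat_def)
  have "(to_mat M *\<^sub>v to_vec v) $ i = (\<Sum>j<CARD('n). M $ enum_at i $ enum_at j * v $ enum_at j)"
    using i by (simp add: to_mat_def to_vec_def scalar_prod_def atLeast0LessThan)
  also have "\<dots> = (M *v v) $ enum_at i"
    by (simp add: sum_enum_at[of "\<lambda>j. M $ enum_at i $ j * v $ j"] matrix_vector_mult_def)
  finally show "to_vec (M *v v) $ i = (to_mat M *\<^sub>v to_vec v) $ i" using i by (simp add: to_vec_def)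
qed (simp add: to_vec_def to_mat_def)

lemma to_vec_funpow:
  "to_vec (((*v) M ^^ k) v) = to_mat M ^\<^sub>m k *\<^sub>v to_vec (v :: 'a::comm_semiring_1^'n::finite)"
proof (induction k arbitrary: v)
  case (Suc k)
  have "to_vec (((*v) M ^^ Suc k) v) = to_mat M ^\<^sub>m k *\<^sub>v (to_mat M *\<^sub>v to_vec v)"
    by (simp only: funpow_Suc_right o_apply Suc.IH to_vec_mult)
  also have "\<dots> = (to_mat M ^\<^sub>m k * to_mat M) *\<^sub>v to_vec v"
    by (rule assoc_mult_mat_vec[symmetric]) auto
  finally show ?case by simp
qed simp

lemma eigenvalue_to_mat: "eigenvalue (to_mat M) lam \<longleftrightarrow> (\<exists>v. v \<noteq> 0 \<and> M *v v = lam *s v)"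
  for M :: "'a::comm_ring_1^'n::finite^'n"
proof
  assume "eigenvalue (to_mat M) lam"
  then obtain u where u: "u \<in> carrier_vec CARD('n)" "u \<noteq> 0\<^sub>v CARD('n)" "to_mat M *\<^sub>v u = lam \<cdot>\<^sub>v u"
    by (auto simp: eigenvalue_def eigenvector_def to_mat_def)
  define v :: "'a^'n" where "v = (\<chi> p. u $ enum_pos p)"
  have uv: "to_vec v = u" unfolding v_def by (rule to_vec_surj[OF u(1)])
  have "to_vec (M *v v) = to_vec (lam *s v)"
    by (simp add: to_vec_mult to_vec_smult uv u(3))
  moreover have "v \<noteq> 0" using u(2) uv to_vec_zero by metis
  ultimately show "\<exists>v. v \<noteq> 0 \<and> M *v v = lam *s v" by (auto simp: to_vec_inject)
next
  assume "\<exists>v. v \<noteq> 0 \<and> M *v v = lam *s v"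
  then obtain v where "v \<noteq> 0" "M *v v = lam *s v" by blast
  moreover from \<open>M *v v = lam *s v\<close> have "to_mat M *\<^sub>v to_vec v = lam \<cdot>\<^sub>v to_vec v"
    by (metis to_vec_mult to_vec_smult)
  ultimately show "eigenvalue (to_mat M) lam"
    unfolding eigenvalue_def eigenvector_def
    by (intro exI[of _ "to_vec v"]) (auto simp: to_vec_inject simp flip: to_vec_zero)
qed

lemma is_eigenvalue_iff_eigenvalue_to_mat: "is_eigenvalue M lam \<longleftrightarrow> eigenvalue (to_mat (cmat M)) lam"
  by (simp add: is_eigenvalue_def eigenvalue_to_mat)

lemma norm_funpow_le_norm_bound:
  fixes M :: "'a::real_normed_field^'n::finite^'n"
  assumes bound: "norm_bound (to_mat M ^\<^sub>m k) b"
  shows "norm (((*v) M ^^ k) v) \<le> real CARD('n) * real CARD('n) * b * norm v"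
proof -
  let ?n = "CARD('n)" and ?P = "to_mat M ^\<^sub>m k"
  have entry: "norm (?P $$ (i, j)) \<le> b" if "i < ?n" "j < ?n" for i j
    using bound that by (simp add: norm_bound_def)
  have b: "0 \<le> b"
    using entry[of 0 0] by (meson norm_ge_zero order_trans zero_less_card_finite)
  have component: "norm ((((*v) M ^^ k) v) $ p) \<le> real ?n * b * norm v" for p
  proof -
    have "(((*v) M ^^ k) v) $ p = (?P *\<^sub>v to_vec v) $ enum_pos p"
      by (simp flip: to_vec_funpow)
    also have "\<dots> = (\<Sum>j<?n. ?P $$ (enum_pos p, j) * to_vec v $ j)"
      by (simp add: scalar_prod_def atLeast0LessThan)
    also have "norm \<dots> \<le> (\<Sum>j<?n. norm (?P $$ (enum_pos p, j)) * norm (to_vec v $ j))"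
      by (rule order_trans[OF norm_sum]) (simp add: norm_mult)
    also have "\<dots> \<le> (\<Sum>j<?n. b * norm v)"
    proof (rule sum_mono)
      fix j assume j: "j \<in> {..<?n}"
      then have "norm (to_vec v $ j) \<le> norm v"
        by (simp add: to_vec_def Finite_Cartesian_Product.norm_nth_le)
      then show "norm (?P $$ (enum_pos p, j)) * norm (to_vec v $ j) \<le> b * norm v"
        using entry[of "enum_pos p" j] j b by (intro mult_mono) auto
    qed
    finally show ?thesis by simp
  qed
  have "norm (((*v) M ^^ k) v) \<le> (\<Sum>p\<in>UNIV. norm ((((*v) M ^^ k) v) $ p))"
    by (simp add: norm_vec_def L2_set_le_sum)
  also have "\<dots> \<le> (\<Sum>p\<in>(UNIV::'n set). real ?n * b * norm v)"
    by (rule sum_mono) (rule component)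
  finally show ?thesis by simp
qed

definition cvec :: "real^'n \<Rightarrow> complex^'n" where
  "cvec v = (\<chi> i. complex_of_real (v $ i))"

lemma norm_cvec [simp]: "norm (cvec v) = norm v"
  by (simp add: cvec_def norm_vec_def)

lemma cmat_mult_cvec: "cmat (M :: real^'n^'m) *v cvec v = cvec (M *v v)"
  by (simp add: Finite_Cartesian_Product.vec_eq_iff cvec_def cmat_def matrix_vector_mult_def)

lemma funpow_cmat_cvec: "((*v) (cmat (M :: real^'n^'n)) ^^ k) (cvec v) = cvec (((*v) M ^^ k) v)"
  by (induction k) (simp_all add: cmat_mult_cvec)

lemma funpow_scaleR_matrix: "((*v) (c *\<^sub>R (M :: real^'n^'n)) ^^ k) v = c ^ k *\<^sub>R ((*v) M ^^ k) v"
  by (induction k) (simp_all add: scaleR_matrix_vector_assoc[symmetric] matrix_vector_mult_scaleR)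

lemma power_bound_eigenvalues_le_1:
  fixes M :: "real^'n^'n"
  assumes eig: "\<And>lam. is_eigenvalue M lam \<Longrightarrow> cmod lam \<le> 1"
  shows "\<exists>c D. \<forall>k v. norm (((*v) M ^^ k) v) \<le> c * (real k + 1) ^ D * norm v"
proof -
  let ?T = "to_mat (cmat M)" and ?n = "CARD('n)"
  have T: "?T \<in> carrier_mat ?n ?n" by simp
  have "spectral_radius ?T \<le> 1"
    using spectral_radius_mem_max(1)[OF T] eig
    by (auto simp: spectrum_def is_eigenvalue_iff_eigenvalue_to_mat)
  then obtain c1 c2 where c: "\<forall>k. norm_bound (?T ^\<^sub>m k) (c1 + c2 * of_nat k ^ (?n - 1))"
    using spectral_radius_jnf_norm_bound_le_1_upper_triangular[OF T] by blast
  define c where "c = \<bar>c1\<bar> + \<bar>c2\<bar>"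
  have bound: "norm_bound (?T ^\<^sub>m k) (c * (real k + 1) ^ (?n - 1))" for k
  proof -
    have "c1 \<le> \<bar>c1\<bar> * (real k + 1) ^ (?n - 1)"
      using mult_left_mono[of 1 "(real k + 1) ^ (?n - 1)" "\<bar>c1\<bar>"] by simp
    moreover have "c2 * real k ^ (?n - 1) \<le> \<bar>c2\<bar> * (real k + 1) ^ (?n - 1)"
      by (intro mult_mono power_mono) auto
    ultimately have "c1 + c2 * real k ^ (?n - 1) \<le> c * (real k + 1) ^ (?n - 1)"
      by (simp add: c_def distrib_right)
    then show ?thesis using c unfolding norm_bound_def by (meson order_trans)
  qed
  have "norm (((*v) M ^^ k) v) \<le> (real ?n * real ?n * c) * (real k + 1) ^ (?n - 1) * norm v" for k v
    using norm_funpow_le_norm_bound[OF bound, of k "cvec v"]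
    by (simp add: funpow_cmat_cvec ac_simps)
  then show ?thesis by blast
qed

lemma power_bound_eigenvalues_le:
  fixes M :: "real^'n^'n"
  assumes r: "0 < r" and eig: "\<And>lam. is_eigenvalue M lam \<Longrightarrow> cmod lam \<le> r"
  shows "\<exists>c D. \<forall>k v. norm (((*v) M ^^ k) v) \<le> c * (real k + 1) ^ D * r ^ k * norm v"
proof -
  define M' where "M' = (1 / r) *\<^sub>R M"
  have "cmod lam \<le> 1" if eig': "is_eigenvalue M' lam" for lam
  proof -
    obtain v where v: "v \<noteq> 0" "cmat M' *v v = lam *s v"
      using eig' by (auto simp: is_eigenvalue_def)
    have "cmat M *v v = complex_of_real r *s (cmat M' *v v)"
      using r by (simp add: Finite_Cartesian_Product.vec_eq_iff cmat_def M'_def matrix_vector_mult_def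
          sum_distrib_left)
    then have "is_eigenvalue M (complex_of_real r * lam)"
      using v by (auto simp: is_eigenvalue_def)
    then have "cmod (complex_of_real r * lam) \<le> r" by (rule eig)
    then show ?thesis using r by (simp add: norm_mult)
  qed
  then obtain c D where c: "\<forall>k v. norm (((*v) M' ^^ k) v) \<le> c * (real k + 1) ^ D * norm v"
    using power_bound_eigenvalues_le_1 by blast
  have "M = r *\<^sub>R M'" using r by (simp add: M'_def)
  then have "norm (((*v) M ^^ k) v) = r ^ k * norm (((*v) M' ^^ k) v)" for k v
    using r by (simp add: funpow_scaleR_matrix)
  then have "norm (((*v) M ^^ k) v) \<le> c * (real k + 1) ^ D * r ^ k * norm v" for k v
    using c r by (simp add: mult_left_mono ac_simps)
  then show ?thesis by blast
qed

lemma schur_stable_poly_exp_decay_op: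
  fixes M :: "real^'n^'n"
  assumes "schur_stable M"
  shows "poly_exp_decay_op (\<lambda>k. (*v) M ^^ k)"
proof -
  let ?T = "to_mat (cmat M)"
  have T: "?T \<in> carrier_mat CARD('n) CARD('n)" by simp
  note spectral_radius = spectral_radius_mem_max[OF T zero_less_card_finite]
  define \<sigma> where "\<sigma> = (1 + spectral_radius ?T) / 2"
  have "spectral_radius ?T < 1"
    using spectral_radius(1) assms
    by (auto simp: spectrum_def schur_stable_def is_eigenvalue_iff_eigenvalue_to_mat)
  moreover have "0 \<le> spectral_radius ?T" using spectral_radius(1) by auto
  moreover have "cmod lam \<le> spectral_radius ?T" if "is_eigenvalue M lam" for lam
    using spectral_radius(2) that by (simp add: spectrum_def is_eigenvalue_iff_eigenvalue_to_mat)
  ultimately have "0 < \<sigma>" "\<sigma> < 1" "\<And>lam. is_eigenvalue M lam \<Longrightarrow> cmod lam \<le> \<sigma>"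
    unfolding \<sigma>_def by fastforce+
  then show ?thesis
    unfolding poly_exp_decay_op_def using power_bound_eigenvalues_le by blast
qed

lemma matrix_vector_mult_sum: "M *v sum f S = (\<Sum>j\<in>S. M *v f j)"
  for M :: "real^'n^'m"
  by (simp add: linear_sum[OF matrix_vector_mul_linear])

lemma forced_recurrence_closed_form:
  fixes M :: "real^'n^'n"
  assumes z: "\<And>k. z (Suc k) = M *v z k + f k"
  shows "z k = ((*v) M ^^ k) (z 0) + (\<Sum>t<k. ((*v) M ^^ (k - 1 - t)) (f t))"
proof (induction k)
  case (Suc k)
  have "(\<Sum>t<k. M *v ((*v) M ^^ (k - 1 - t)) (f t)) = (\<Sum>t<k. ((*v) M ^^ (Suc k - 1 - t)) (f t))"
  proof (rule sum.cong[OF refl])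
    fix t assume "t \<in> {..<k}"
    then have "Suc k - 1 - t = Suc (k - 1 - t)" by auto
    then show "M *v ((*v) M ^^ (k - 1 - t)) (f t) = ((*v) M ^^ (Suc k - 1 - t)) (f t)" by simp
  qed
  then show ?case
    by (simp add: z Suc matrix_vector_right_distrib matrix_vector_mult_sum)
qed simp

lemma schur_forced_poly_exp_decay:
  assumes "schur_stable M" "poly_exp_decay f" "\<And>k. z (Suc k) = M *v z k + f k"
  shows "poly_exp_decay z"
proof -
  have M: "poly_exp_decay_op (\<lambda>k. (*v) M ^^ k)" by (rule schur_stable_poly_exp_decay_op[OF assms(1)])
  have z: "z = (\<lambda>k. ((*v) M ^^ k) (z 0) + (\<Sum>t<k. ((*v) M ^^ (k - 1 - t)) (f t)))"
    by (rule ext) (rule forced_recurrence_closed_form[where z = z and M = M and f = f, OF assms(3)])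
  show ?thesis
    by (subst z) (intro poly_exp_decay_add poly_exp_decay_op_apply poly_exp_decay_convolution M assms(2))
qed

section \<open>Powers of a row-stochastic matrix\<close>

primrec mpow :: "nat \<Rightarrow> (nat \<Rightarrow> nat \<Rightarrow> real) \<Rightarrow> nat \<Rightarrow> nat \<Rightarrow> nat \<Rightarrow> real" where
  "mpow N d 0 i j = (if i = j then 1 else 0)"
| "mpow N d (Suc k) i j = (\<Sum>l<N. d i l * mpow N d k l j)"

lemma pow_div_le_root_pow:
  assumes q: "0 < q" "q < 1" and L: "0 < L"
  shows "q ^ (s div L) \<le> (1 / q) * root L q ^ s"
proof -
  define \<rho> where "\<rho> = root L q"
  have \<rho>: "0 < \<rho>" "\<rho> \<le> 1" "\<rho> ^ L = q"
    using q L by (auto simp: \<rho>_def real_root_pow_pos2)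
  have "\<rho> ^ s = \<rho> ^ (L * (s div L) + s mod L)" by simp
  also have "\<dots> = q ^ (s div L) * \<rho> ^ (s mod L)" by (simp only: power_add power_mult \<rho>(3))
  finally have eq: "\<rho> ^ s = q ^ (s div L) * \<rho> ^ (s mod L)" .
  have "\<rho> ^ L \<le> \<rho> ^ (s mod L)" using \<rho> L by (intro power_decreasing) auto
  then have "q ^ (s div L) * q \<le> \<rho> ^ s" unfolding eq \<rho>(3) using q by (intro mult_left_mono) auto
  then show ?thesis using q by (simp add: \<rho>_def field_simps)
qed

locale row_stochastic =
  fixes N :: nat and d :: "nat \<Rightarrow> nat \<Rightarrow> real"
  assumes nonneg: "\<And>i j. i < N \<Longrightarrow> j < N \<Longrightarrow> 0 \<le> d i j"
    and row_sum: "\<And>i. i < N \<Longrightarrow> (\<Sum>j<N. d i j) = 1"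
begin

lemma mpow_nonneg: "i < N \<Longrightarrow> j < N \<Longrightarrow> 0 \<le> mpow N d k i j"
  by (induction k arbitrary: i) (auto intro!: sum_nonneg mult_nonneg_nonneg nonneg)

lemma mpow_row_sum: "i < N \<Longrightarrow> (\<Sum>j<N. mpow N d k i j) = 1"
proof (induction k arbitrary: i)
  case (Suc k)
  have "(\<Sum>j<N. mpow N d (Suc k) i j) = (\<Sum>j<N. \<Sum>l<N. d i l * mpow N d k l j)"
    by simp
  also have "\<dots> = (\<Sum>l<N. \<Sum>j<N. d i l * mpow N d k l j)"
    by (rule sum.swap)
  also have "\<dots> = (\<Sum>l<N. d i l * (\<Sum>j<N. mpow N d k l j))"
    by (simp add: sum_distrib_left)
  also have "\<dots> = 1" using Suc by (simp add: row_sum)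
  finally show ?case .
qed simp

lemma mpow_le_1: "i < N \<Longrightarrow> j < N \<Longrightarrow> mpow N d k i j \<le> 1"
  using member_le_sum[of j "{..<N}" "mpow N d k i"] mpow_nonneg mpow_row_sum by simp

lemma mpow_add: "i < N \<Longrightarrow> mpow N d (m + s) i j = (\<Sum>l<N. mpow N d m i l * mpow N d s l j)"
proof (induction m arbitrary: i)
  case 0
  have "(\<Sum>l<N. mpow N d 0 i l * mpow N d s l j) = (\<Sum>l<N. if l = i then mpow N d s l j else 0)"
    by (rule sum.cong) auto
  then show ?case using 0 by simp
next
  case (Suc m)
  have "mpow N d (Suc m + s) i j = (\<Sum>q<N. d i q * (\<Sum>l<N. mpow N d m q l * mpow N d s l j))"
    using Suc.IH by simp
  also have "\<dots> = (\<Sum>q<N. \<Sum>l<N. d i q * mpow N d m q l * mpow N d s l j)"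
    by (simp add: sum_distrib_left mult.assoc)
  also have "\<dots> = (\<Sum>l<N. \<Sum>q<N. d i q * mpow N d m q l * mpow N d s l j)"
    by (rule sum.swap)
  also have "\<dots> = (\<Sum>l<N. mpow N d (Suc m) i l * mpow N d s l j)"
    by (simp add: sum_distrib_right)
  finally show ?case .
qed

lemma mpow_lower_bound_along_path:
  assumes r: "r < N" and \<beta>: "0 \<le> \<beta>" "\<beta> \<le> d r r"
    and par: "\<And>i. i < N \<Longrightarrow> i \<noteq> r \<Longrightarrow> par i < N \<and> \<beta> \<le> d i (par i)"
  shows "i < N \<Longrightarrow> (par ^^ k) i = r \<Longrightarrow> k \<le> m \<Longrightarrow> \<beta> ^ m \<le> mpow N d m i r"
proof (induction m arbitrary: i k)
  case (Suc m)
  \<comment> \<open>walk along the parent map, and stay at the root along its self-loop\<close>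
  define p where "p = (if i = r then r else par i)"
  have p: "p < N" "\<beta> \<le> d i p" "\<beta> ^ m \<le> mpow N d m p r"
  proof -
    show "p < N" "\<beta> \<le> d i p" using par[OF Suc.prems(1)] r \<beta> by (auto simp: p_def)
    show "\<beta> ^ m \<le> mpow N d m p r"
    proof (cases "i = r")
      case True
      then show ?thesis using Suc.IH[of r 0] r by (simp add: p_def)
    next
      case False
      then obtain k' where k: "k = Suc k'" using Suc.prems by (cases k) auto
      then have "(par ^^ k') (par i) = r" using Suc.prems(2) by (simp add: funpow_swap1)
      then show ?thesis using Suc.IH[of "par i" k'] par[OF Suc.prems(1) False] Suc.prems k False
        by (simp add: p_def)
    qed
  qed
  have "\<beta> * \<beta> ^ m \<le> d i p * mpow N d m p r"
    using p \<beta> by (intro mult_mono) auto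
  also have "\<dots> \<le> (\<Sum>l<N. d i l * mpow N d m l r)"
    by (rule member_le_sum[of p _ "\<lambda>l. d i l * mpow N d m l r"])
       (use p r Suc.prems in \<open>auto intro!: mult_nonneg_nonneg nonneg mpow_nonneg\<close>)
  finally show ?case by simp
qed simp

lemma mpow_contraction:
  assumes r: "r < N" and i: "i < N" and \<gamma>: "\<gamma> \<le> mpow N d L i r"
    and y: "\<And>l. l < N \<Longrightarrow> lo \<le> y l \<and> y l \<le> hi"
  shows "lo + \<gamma> * (y r - lo) \<le> (\<Sum>l<N. mpow N d L i l * y l)"
    and "(\<Sum>l<N. mpow N d L i l * y l) \<le> hi - \<gamma> * (hi - y r)"
proof -
  have rows: "(\<Sum>l<N. mpow N d L i l) = 1" by (rule mpow_row_sum[OF i])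
  have "\<gamma> * (y r - lo) \<le> mpow N d L i r * (y r - lo)"
    using \<gamma> y[OF r] by (intro mult_right_mono) auto
  also have "\<dots> \<le> (\<Sum>l<N. mpow N d L i l * (y l - lo))"
    by (rule member_le_sum[of r _ "\<lambda>l. mpow N d L i l * (y l - lo)"])
       (use r i y in \<open>auto intro!: mult_nonneg_nonneg mpow_nonneg\<close>)
  also have "\<dots> = (\<Sum>l<N. mpow N d L i l * y l) - (\<Sum>l<N. mpow N d L i l) * lo"
    by (simp add: right_diff_distrib sum_subtractf sum_distrib_right)
  finally show "lo + \<gamma> * (y r - lo) \<le> (\<Sum>l<N. mpow N d L i l * y l)" using rows by simp
  have "\<gamma> * (hi - y r) \<le> mpow N d L i r * (hi - y r)"
    using \<gamma> y[OF r] by (intro mult_right_mono) auto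
  also have "\<dots> \<le> (\<Sum>l<N. mpow N d L i l * (hi - y l))"
    by (rule member_le_sum[of r _ "\<lambda>l. mpow N d L i l * (hi - y l)"])
       (use r i y in \<open>auto intro!: mult_nonneg_nonneg mpow_nonneg\<close>)
  also have "\<dots> = (\<Sum>l<N. mpow N d L i l) * hi - (\<Sum>l<N. mpow N d L i l * y l)"
    by (simp add: right_diff_distrib sum_subtractf sum_distrib_right)
  finally show "(\<Sum>l<N. mpow N d L i l * y l) \<le> hi - \<gamma> * (hi - y r)" using rows by simp
qed

lemma mpow_column_oscillation:
  assumes r: "r < N" and L: "0 < L" and \<gamma>: "\<gamma> \<le> 1" "\<And>i. i < N \<Longrightarrow> \<gamma> \<le> mpow N d L i r"
    and j: "j < N"
  shows "\<exists>lo hi. hi - lo \<le> (1 - \<gamma>) ^ (s div L) \<and>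
           (\<forall>i<N. lo \<le> mpow N d s i j \<and> mpow N d s i j \<le> hi)"
proof (induction s rule: less_induct)
  case (less s)
  show ?case
  proof (cases "s < L")
    case True
    then show ?thesis using mpow_nonneg mpow_le_1 j by (intro exI[of _ 0] exI[of _ 1]) auto
  next
    case False
    then obtain s' where s: "s = L + s'" by (metis le_add_diff_inverse not_less)
    then obtain lo hi where lh: "hi - lo \<le> (1 - \<gamma>) ^ (s' div L)"
      "\<forall>i<N. lo \<le> mpow N d s' i j \<and> mpow N d s' i j \<le> hi"
      using less.IH[of s'] L by auto
    define y where "y l = mpow N d s' l j" for l
    have y_bounds: "lo \<le> y l \<and> y l \<le> hi" if "l < N" for l using lh(2) that by (simp add: y_def)
    have "lo + \<gamma> * (y r - lo) \<le> mpow N d s i j \<and> mpow N d s i j \<le> hi - \<gamma> * (hi - y r)"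
      if i: "i < N" for i
    proof -
      have "mpow N d s i j = (\<Sum>l<N. mpow N d L i l * y l)"
        unfolding s y_def by (rule mpow_add[OF i])
      then show ?thesis
        using mpow_contraction[where y = y and lo = lo and hi = hi, OF r i \<gamma>(2)[OF i] y_bounds] by simp
    qed
    moreover have "(hi - \<gamma> * (hi - y r)) - (lo + \<gamma> * (y r - lo)) \<le> (1 - \<gamma>) ^ (s div L)"
    proof -
      have "(hi - \<gamma> * (hi - y r)) - (lo + \<gamma> * (y r - lo)) = (1 - \<gamma>) * (hi - lo)"
        by (simp add: algebra_simps)
      also have "\<dots> \<le> (1 - \<gamma>) * (1 - \<gamma>) ^ (s' div L)"
        using lh(1) \<gamma>(1) by (intro mult_left_mono) auto
      also have "\<dots> = (1 - \<gamma>) ^ (s div L)" using L s by simp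
      finally show ?thesis .
    qed
    ultimately show ?thesis by blast
  qed
qed

lemma mpow_rows_converge:
  assumes r: "r < N" and L: "0 < L" and \<gamma>: "0 < \<gamma>" "\<And>i. i < N \<Longrightarrow> \<gamma> \<le> mpow N d L i r"
    and i: "i < N" and m: "m < N" and j: "j < N"
  shows "poly_exp_decay (\<lambda>s. mpow N d s i j - mpow N d s m j)"
proof -
  define q where "q = 1 - min \<gamma> (1/2)"
  have q: "0 < q" "q < 1" using \<gamma>(1) by (auto simp: q_def)
  have "\<bar>mpow N d s i j - mpow N d s m j\<bar> \<le> (1 / q) * root L q ^ s" for s
  proof -
    have "min \<gamma> (1/2) \<le> 1" by simp
    moreover have "min \<gamma> (1/2) \<le> mpow N d L i r" if "i < N" for i
      using \<gamma>(2)[OF that] by linarith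
    ultimately obtain lo hi where osc: "hi - lo \<le> q ^ (s div L)"
      "\<forall>i<N. lo \<le> mpow N d s i j \<and> mpow N d s i j \<le> hi"
      using mpow_column_oscillation[OF r L _ _ j, of "min \<gamma> (1/2)" s] unfolding q_def by blast
    from osc(2) i m have "lo \<le> mpow N d s i j" "mpow N d s i j \<le> hi"
      "lo \<le> mpow N d s m j" "mpow N d s m j \<le> hi" by auto
    with osc(1) have "\<bar>mpow N d s i j - mpow N d s m j\<bar> \<le> q ^ (s div L)"
      unfolding abs_le_iff by linarith
    also have "\<dots> \<le> (1 / q) * root L q ^ s" by (rule pow_div_le_root_pow[OF q L])
    finally show ?thesis .
  qed
  moreover have "0 < root L q" "root L q < 1" using q L by auto
  ultimately show ?thesis
    unfolding poly_exp_decay_def by (intro exI[of _ "1 / q"] exI[of _ 0] exI[of _ "root L q"]) auto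
qed

end

lemma din_nonneg: "weighted_digraph N a \<Longrightarrow> i < N \<Longrightarrow> 0 \<le> din N a i"
  by (auto simp: din_def weighted_digraph_def intro: sum_nonneg)

lemma row_stochastic_dmat:
  assumes a: "weighted_digraph N a"
  shows "row_stochastic N (dmat N a)"
proof
  fix i j assume "i < N" "j < N"
  then show "0 \<le> dmat N a i j"
    using a din_nonneg[OF a] by (auto simp: dmat_def weighted_digraph_def)
next
  fix i assume i: "i < N"
  have "(\<Sum>j<N. dmat N a i j) = (\<Sum>j<N. (a i j + (if j = i then 1 else 0)) / (1 + din N a i))"
    by (rule sum.cong) (use a i in \<open>auto simp: dmat_def weighted_digraph_def\<close>)
  also have "\<dots> = (\<Sum>j<N. a i j + (if j = i then 1 else 0)) / (1 + din N a i)"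
    by (rule sum_divide_distrib[symmetric])
  also have "\<dots> = 1" using i din_nonneg[OF a i] by (simp add: sum.distrib din_def)
  finally show "(\<Sum>j<N. dmat N a i j) = 1" .
qed

lemma spanning_tree_root_weight:
  assumes a: "weighted_digraph N a" and tree: "has_spanning_tree N a"
  shows "\<exists>r L \<gamma>. r < N \<and> 0 < L \<and> 0 < \<gamma> \<and> (\<forall>i<N. \<gamma> \<le> mpow N (dmat N a) L i r)"
proof -
  interpret row_stochastic N "dmat N a" by (rule row_stochastic_dmat[OF a])
  obtain r par where r: "r < N" and par: "\<forall>i<N. i \<noteq> r \<longrightarrow> par i < N \<and> a i (par i) > 0"
    and reach: "\<forall>i<N. \<exists>k. (par ^^ k) i = r"
    using tree unfolding has_spanning_tree_def by blast
  define w where "w i = (if i = r then dmat N a r r else dmat N a i (par i))" for i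
  define \<beta> where "\<beta> = Min (w ` {..<N})"
  have "0 < w i" if "i < N" for i
    using par that din_nonneg[OF a that] by (auto simp: w_def dmat_def)
  then have \<beta>: "0 < \<beta>" unfolding \<beta>_def using r by (subst Min_gr_iff) auto
  have \<beta>w: "\<beta> \<le> w i" if "i < N" for i unfolding \<beta>_def using that by (intro Min_le) auto
  define k where "k i = (SOME k. (par ^^ k) i = r)" for i
  have k: "(par ^^ k i) i = r" if "i < N" for i
    unfolding k_def by (rule someI_ex) (use reach that in blast)
  define L where "L = Suc (\<Sum>i<N. k i)"
  have "k i \<le> L" if "i < N" for i
    using member_le_sum[of i "{..<N}" k] that by (simp add: L_def)
  moreover have "par i < N \<and> \<beta> \<le> dmat N a i (par i)" if "i < N" "i \<noteq> r" for i
    using par \<beta>w[OF that(1)] that by (simp add: w_def)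
  moreover have "\<beta> \<le> dmat N a r r" using \<beta>w[OF r] by (simp add: w_def)
  ultimately have "\<beta> ^ L \<le> mpow N (dmat N a) L i r" if "i < N" for i
    using mpow_lower_bound_along_path[OF r less_imp_le[OF \<beta>]] that k[OF that] by blast
  then show ?thesis using r \<beta> by (intro exI[of _ r] exI[of _ L] exI[of _ "\<beta> ^ L"]) (auto simp: L_def)
qed

lemma dmat_rows_converge:
  assumes "weighted_digraph N a" "has_spanning_tree N a" "i < N" "m < N" "j < N"
  shows "poly_exp_decay (\<lambda>s. mpow N (dmat N a) s i j - mpow N (dmat N a) s m j)"
proof -
  interpret row_stochastic N "dmat N a" by (rule row_stochastic_dmat[OF assms(1)])
  show ?thesis
    using spanning_tree_root_weight[OF assms(1,2)] mpow_rows_converge assms(3-5) by blast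
qed

section \<open>Networks of identical linear agents\<close>

(* Component i of (D \<otimes> A)^k X for the network state X = (X 0, ..., X (N - 1)). *)
definition kron_pow ::
    "nat \<Rightarrow> (nat \<Rightarrow> nat \<Rightarrow> real) \<Rightarrow> real^'n^'n \<Rightarrow> nat \<Rightarrow> (nat \<Rightarrow> real^'n) \<Rightarrow> nat \<Rightarrow> real^'n"
  where "kron_pow N d A k X i = (\<Sum>j<N. mpow N d k i j *\<^sub>R ((*v) A ^^ k) (X j))"

lemma kron_pow_0: "i < N \<Longrightarrow> kron_pow N d A 0 X i = X i"
proof -
  assume "i < N"
  have "kron_pow N d A 0 X i = (\<Sum>j<N. if j = i then X j else 0)"
    unfolding kron_pow_def by (rule sum.cong) auto
  with \<open>i < N\<close> show ?thesis by simp
qed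

lemma kron_pow_Suc:
  "(\<Sum>l<N. d i l *\<^sub>R (A *v kron_pow N d A k X l)) = kron_pow N d A (Suc k) X i"
proof -
  have "(\<Sum>l<N. d i l *\<^sub>R (A *v kron_pow N d A k X l))
        = (\<Sum>l<N. \<Sum>j<N. (d i l * mpow N d k l j) *\<^sub>R ((*v) A ^^ Suc k) (X j))"
    by (simp add: kron_pow_def matrix_vector_mult_sum matrix_vector_mult_scaleR scaleR_sum_right)
  also have "\<dots> = (\<Sum>j<N. \<Sum>l<N. (d i l * mpow N d k l j) *\<^sub>R ((*v) A ^^ Suc k) (X j))"
    by (rule sum.swap)
  also have "\<dots> = kron_pow N d A (Suc k) X i"
    by (simp add: kron_pow_def scaleR_sum_left)
  finally show ?thesis .
qed

lemma kron_pow_disagreement: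
  "kron_pow N d A k X i - kron_pow N d A k X m
   = (\<Sum>j<N. (mpow N d k i j - mpow N d k m j) *\<^sub>R ((*v) A ^^ k) (X j))"
  by (simp add: kron_pow_def sum_subtractf scaleR_left_diff_distrib)

lemma network_recurrence_closed_form:
  assumes w: "\<And>k i. i < N \<Longrightarrow> w (Suc k) i = A *v ((\<Sum>j<N. d i j *\<^sub>R w k j) + e k i)"
  shows "i < N \<Longrightarrow>
    w k i = kron_pow N d A k (w 0) i + (\<Sum>t<k. kron_pow N d A (k - 1 - t) (\<lambda>j. A *v e t j) i)"
proof (induction k arbitrary: i)
  case 0
  then show ?case by (simp add: kron_pow_0)
next
  case (Suc k)
  let ?E = "\<lambda>t j. A *v e t j"
  have "(\<Sum>j<N. d i j *\<^sub>R w k j) = (\<Sum>j<N. d i j *\<^sub>R kron_pow N d A k (w 0) j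
          + (\<Sum>t<k. d i j *\<^sub>R kron_pow N d A (k - 1 - t) (?E t) j))"
    by (rule sum.cong) (simp_all add: Suc.IH scaleR_add_right scaleR_sum_right)
  also have "\<dots> = (\<Sum>j<N. d i j *\<^sub>R kron_pow N d A k (w 0) j)
          + (\<Sum>t<k. \<Sum>j<N. d i j *\<^sub>R kron_pow N d A (k - 1 - t) (?E t) j)"
    by (simp add: sum.distrib sum.swap[of _ "{..<N}" "{..<k}"])
  finally have "w (Suc k) i = kron_pow N d A (Suc k) (w 0) i
                + (\<Sum>t<k. kron_pow N d A (Suc (k - 1 - t)) (?E t) i) + kron_pow N d A 0 (?E k) i"
    using Suc.prems
    by (simp add: w matrix_vector_right_distrib matrix_vector_mult_sum matrix_vector_mult_scaleR
        kron_pow_Suc kron_pow_0)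
  moreover have "(\<Sum>t<k. kron_pow N d A (Suc (k - 1 - t)) (?E t) i)
                 = (\<Sum>t<k. kron_pow N d A (Suc k - 1 - t) (?E t) i)"
  proof (rule sum.cong[OF refl])
    fix t assume "t \<in> {..<k}"
    then have "Suc k - 1 - t = Suc (k - 1 - t)" by auto
    then show "kron_pow N d A (Suc (k - 1 - t)) (?E t) i = kron_pow N d A (Suc k - 1 - t) (?E t) i"
      by simp
  qed
  ultimately show ?case by simp
qed

lemma disagreement_poly_exp_decay:
  fixes A :: "real^'n^'n"
  assumes w: "\<And>k i. i < N \<Longrightarrow> w (Suc k) i = A *v ((\<Sum>j<N. d i j *\<^sub>R w k j) + e k i)"
    and rows: "\<And>j. j < N \<Longrightarrow> poly_exp_decay (\<lambda>s. mpow N d s i j - mpow N d s m j)"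
    and A: "\<And>k v. norm (((*v) A ^^ k) v) \<le> c * (real k + 1) ^ D * norm v"
    and e: "\<And>j. j < N \<Longrightarrow> poly_exp_decay (\<lambda>k. e k j)"
    and i: "i < N" and m: "m < N"
  shows "poly_exp_decay (\<lambda>k. w k i - w k m)"
proof -
  define F where "F j k v = (mpow N d k i j - mpow N d k m j) *\<^sub>R ((*v) A ^^ k) v" for j k v
  have F: "poly_exp_decay_op (F j)" if "j < N" for j
    unfolding F_def by (rule poly_exp_decay_op_scaleR[OF rows[OF that] A])
  have diff: "w k i - w k m = (\<Sum>j<N. F j k (w 0 j)) + (\<Sum>j<N. \<Sum>t<k. F j (k - 1 - t) (A *v e t j))"
    for k
  proof -
    have "w k i - w k m = (kron_pow N d A k (w 0) i - kron_pow N d A k (w 0) m)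
        + (\<Sum>t<k. kron_pow N d A (k - 1 - t) (\<lambda>j. A *v e t j) i
                   - kron_pow N d A (k - 1 - t) (\<lambda>j. A *v e t j) m)"
      using network_recurrence_closed_form[where N = N and d = d and A = A and w = w and e = e and k = k,
          OF w] i m
      by (simp add: sum_subtractf)
    also have "\<dots> = (\<Sum>j<N. F j k (w 0 j)) + (\<Sum>t<k. \<Sum>j<N. F j (k - 1 - t) (A *v e t j))"
      by (simp add: kron_pow_disagreement F_def)
    also have "(\<Sum>t<k. \<Sum>j<N. F j (k - 1 - t) (A *v e t j)) = (\<Sum>j<N. \<Sum>t<k. F j (k - 1 - t) (A *v e t j))"
      by (rule sum.swap)
    finally show ?thesis .
  qed
  have eq: "(\<lambda>k. w k i - w k m)
      = (\<lambda>k. (\<Sum>j<N. F j k (w 0 j)) + (\<Sum>j<N. \<Sum>t<k. F j (k - 1 - t) (A *v e t j)))"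
    by (rule ext) (rule diff)
  show ?thesis
    unfolding eq
    by (intro poly_exp_decay_add poly_exp_decay_sum poly_exp_decay_op_apply poly_exp_decay_convolution
        F poly_exp_decay_bounded_linear[OF matrix_vector_mul_bounded_linear] e finite_lessThan)
       simp_all
qed

locale sync_protocol =
  fixes A :: "real^'n^'n" and B :: "real^'m^'n" and C :: "real^'n^'p"
    and K :: "real^'n^'m" and H :: "real^'p^'n"
    and N :: nat and d :: "nat \<Rightarrow> nat \<Rightarrow> real"
    and x eta xh :: "nat \<Rightarrow> nat \<Rightarrow> real^'n" and u :: "nat \<Rightarrow> nat \<Rightarrow> real^'m"
  assumes row_sum: "\<And>i. i < N \<Longrightarrow> (\<Sum>j<N. d i j) = 1"
    and x_Suc: "\<And>k i. i < N \<Longrightarrow> x (Suc k) i = A *v x k i + B *v u k i"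
    and eta_Suc: "\<And>k i. i < N \<Longrightarrow> eta (Suc k) i = A *v eta k i + B *v u k i + A *v xh k i
                     - A *v (\<Sum>j<N. d i j *\<^sub>R (eta k i - eta k j))"
    and xh_Suc: "\<And>k i. i < N \<Longrightarrow> xh (Suc k) i = A *v xh k i
                     - (B ** K) *v (\<Sum>j<N. d i j *\<^sub>R (eta k i - eta k j))
                     + H *v ((\<Sum>j<N. d i j *\<^sub>R (C *v x k i - C *v x k j)) - C *v xh k i)"
    and u_feedback: "\<And>k i. i < N \<Longrightarrow> u k i = - (K *v eta k i)"
begin

definition w :: "nat \<Rightarrow> nat \<Rightarrow> real^'n" where
  "w k i = x k i - eta k i"

(* xh_i observes the relative state \<Sum>j. d_ij (x_i - x_j), whose output is zeta_i. *)
definition e :: "nat \<Rightarrow> nat \<Rightarrow> real^'n" where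
  "e k i = (\<Sum>j<N. d i j *\<^sub>R (x k i - x k j)) - xh k i"

lemma x_Suc_closed_loop: "i < N \<Longrightarrow> x (Suc k) i = (A - B ** K) *v x k i + (B ** K) *v w k i"
  by (simp add: x_Suc u_feedback w_def matrix_vector_mult_diff_distrib matrix_vector_mult_diff_rdistrib
      matrix_vector_mul_assoc linear_neg[OF matrix_vector_mul_linear])

lemma e_Suc: "i < N \<Longrightarrow> e (Suc k) i = (A - H ** C) *v e k i"
  by (simp add: e_def x_Suc_closed_loop xh_Suc w_def matrix_vector_mult_sum algebra_simps
      matrix_vector_mul_assoc sum_subtractf scaleR_sum_right)

lemma w_Suc: "i < N \<Longrightarrow> w (Suc k) i = A *v ((\<Sum>j<N. d i j *\<^sub>R w k j) + e k i)"
proof -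
  assume i: "i < N"
  have "w (Suc k) i = A *v (w k i - xh k i + (\<Sum>j<N. d i j *\<^sub>R (eta k i - eta k j)))"
    using i by (simp add: w_def x_Suc eta_Suc algebra_simps)
  also have "w k i - xh k i + (\<Sum>j<N. d i j *\<^sub>R (eta k i - eta k j))
             = (\<Sum>j<N. d i j *\<^sub>R w k j) + e k i + (1 - (\<Sum>j<N. d i j)) *\<^sub>R w k i"
    by (simp add: w_def e_def algebra_simps sum_subtractf scaleR_sum_left)
  finally show ?thesis using i by (simp add: row_sum)
qed

lemma synchronizes:
  assumes eig: "\<And>lam. is_eigenvalue A lam \<Longrightarrow> cmod lam \<le> 1"
    and K: "schur_stable (A - B ** K)" and H: "schur_stable (A - H ** C)"
    and rows: "\<And>i m j. i < N \<Longrightarrow> m < N \<Longrightarrow> j < N \<Longrightarrow>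
                 poly_exp_decay (\<lambda>s. mpow N d s i j - mpow N d s m j)"
    and i: "i < N" and m: "m < N"
  shows "(\<lambda>k. x k i - x k m) \<longlonglongrightarrow> 0"
proof -
  obtain c D where A: "\<And>k v. norm (((*v) A ^^ k) v) \<le> c * (real k + 1) ^ D * norm v"
    using power_bound_eigenvalues_le_1[OF eig] by blast
  have "poly_exp_decay (\<lambda>k. e k j)" if j: "j < N" for j
  proof -
    have "e k j = ((*v) (A - H ** C) ^^ k) (e 0 j)" for k
      by (induction k) (simp_all add: e_Suc[OF j])
    then have "(\<lambda>k. e k j) = (\<lambda>k. ((*v) (A - H ** C) ^^ k) (e 0 j))" by (rule ext)
    then show ?thesis
      using poly_exp_decay_op_apply[OF schur_stable_poly_exp_decay_op[OF H]] by (simp only:)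
  qed
  then have "poly_exp_decay (\<lambda>k. w k i - w k m)"
    using disagreement_poly_exp_decay[where N = N and d = d and A = A and w = w and e = e,
        OF w_Suc rows[OF i m] A _ i m] by blast
  then have "poly_exp_decay (\<lambda>k. (B ** K) *v (w k i - w k m))"
    by (rule poly_exp_decay_bounded_linear[OF matrix_vector_mul_bounded_linear])
  moreover have "x (Suc k) i - x (Suc k) m = (A - B ** K) *v (x k i - x k m) + (B ** K) *v (w k i - w k m)"
    for k by (simp add: x_Suc_closed_loop i m matrix_vector_mult_diff_distrib)
  ultimately have "poly_exp_decay (\<lambda>k. x k i - x k m)"
    by (rule schur_forced_poly_exp_decay[OF K])
  then show ?thesis by (rule poly_exp_decay_tendsto_zero)
qed

end

theorem theorem2:
  fixes A :: "real^'n^'n" and B :: "real^'m^'n" and C :: "real^'n^'p"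
    and K :: "real^'n^'m" and H :: "real^'p^'n"
  assumes eigA: "\<And>lam. is_eigenvalue A lam \<Longrightarrow> cmod lam \<le> 1"
    and stab: "stabilizable A B" and det: "detectable C A"
    and K: "schur_stable (A - B ** K)" and H: "schur_stable (A - H ** C)"
  shows "\<forall>(N::nat) (a::nat \<Rightarrow> nat \<Rightarrow> real)
            (x::nat \<Rightarrow> nat \<Rightarrow> real^'n) (eta::nat \<Rightarrow> nat \<Rightarrow> real^'n)
            (xh::nat \<Rightarrow> nat \<Rightarrow> real^'n) (u::nat \<Rightarrow> nat \<Rightarrow> real^'m).
     N \<ge> 2 \<and> weighted_digraph N a \<and> has_spanning_tree N a \<and>
     (\<forall>k. \<forall>i<N.
        x (Suc k) i = A *v x k i + B *v u k i \<and>
        eta (Suc k) i = A *v eta k i + B *v u k i + A *v xh k i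
             - A *v (\<Sum>j<N. dmat N a i j *\<^sub>R (eta k i - eta k j)) \<and>
        xh (Suc k) i = A *v xh k i - (B ** K) *v (\<Sum>j<N. dmat N a i j *\<^sub>R (eta k i - eta k j))
             + H *v ((\<Sum>j<N. dmat N a i j *\<^sub>R (C *v x k i - C *v x k j)) - C *v xh k i) \<and>
        u k i = - (K *v eta k i))
     \<longrightarrow> (\<forall>i<N. \<forall>j<N. (\<lambda>k. x k i - x k j) \<longlonglongrightarrow> 0)"
  apply (intro allI impI)
  subgoal premises hyp for N a x eta xh u i j
  proof -
    from hyp(1) have a: "weighted_digraph N a" "has_spanning_tree N a" by blast+
    have "sync_protocol A B C K H N (dmat N a) x eta xh u"
      by unfold_locales (use hyp(1) row_stochastic.row_sum[OF row_stochastic_dmat[OF a(1)]] in blast)+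
    then show ?thesis
      by (rule sync_protocol.synchronizes[OF _ eigA K H dmat_rows_converge[OF a] hyp(2,3)])
  qed
  done

end
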